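(* Let $E$ be a Banach lattice and $Y$ a Banach space. Then the set $\mathrm{L}_{\mathrm{qKB}}(E,Y)$ of all quasi-KB operators from $E$ to $Y$ is a Banach space under the operator norm.
   Context: All vector spaces are real and all operators are linear and bounded. For a Banach lattice $E$, $B_E$ is the closed unit ball, $E_+$ the positive cone, and $(B_E)_+=B_E\cap E_+$. A bounded operator $T:E\to Y$ is quasi-KB if $(Tx_\alpha)$ is norm convergent in $Y$ for every increasing net $(x_\alpha)$ in $(B_E)_+$; the set of all such operators is denoted $\mathrm{L}_{\mathrm{qKB}}(E,Y)$. The vector space operations are the pointwise ones. *)

theory Defs
  imports "HOL-Analysis.Analysis" "HOL-Library.Lattice_Algebras"
begin

class banach_lattice = banach + ordered_real_vector + lattice_ab_group_add_abs +
  assumes norm_lattice_mono: "\<bar>x\<bar> \<le> \<bar>y\<bar> \<Longrightarrow> norm x \<le> norm y"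

instance real :: banach_lattice
  by standard simp

definition pos_unit_ball :: "'a::banach_lattice set" where
  "pos_unit_ball = cball 0 1 \<inter> {x. 0 \<le> x}"

definition directed_preorder :: "'i set \<Rightarrow> ('i \<Rightarrow> 'i \<Rightarrow> bool) \<Rightarrow> bool" where
  "directed_preorder I le \<longleftrightarrow> I \<noteq> {} \<and> reflp_on I le \<and> transp_on I le \<and>
     (\<forall>i\<in>I. \<forall>j\<in>I. \<exists>k\<in>I. le i k \<and> le j k)"

text \<open>The filter of tails of a directed index set, so that convergence of a net
  indexed by it is the usual filter limit.\<close>

definition tails :: "'i set \<Rightarrow> ('i \<Rightarrow> 'i \<Rightarrow> bool) \<Rightarrow> 'i filter" where
  "tails I le = (INF i\<in>I. principal {j\<in>I. le i j})"

lemma eventually_tails: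
  assumes "directed_preorder I le"
  shows "eventually P (tails I le) \<longleftrightarrow> (\<exists>i\<in>I. \<forall>j\<in>I. le i j \<longrightarrow> P j)"
proof -
  have "eventually P (tails I le) \<longleftrightarrow> (\<exists>i\<in>I. eventually P (principal {j\<in>I. le i j}))"
    unfolding tails_def
  proof (rule eventually_INF_base)
    show "I \<noteq> {}" using assms by (simp add: directed_preorder_def)
    fix a b assume ab: "a \<in> I" "b \<in> I"
    then obtain k where k: "k \<in> I" "le a k" "le b k"
      using assms unfolding directed_preorder_def by blast
    have "transp_on I le" using assms by (simp add: directed_preorder_def)
    then have "{j\<in>I. le k j} \<subseteq> {j\<in>I. le a j} \<inter> {j\<in>I. le b j}"
      using ab k by (auto dest: transp_onD)
    then show "\<exists>x\<in>I. principal {j\<in>I. le x j} \<le>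
        inf (principal {j\<in>I. le a j}) (principal {j\<in>I. le b j})"
      using k(1) by auto
  qed
  then show ?thesis by (auto simp: eventually_principal)
qed

definition increasing_net ::
    "'i set \<Rightarrow> ('i \<Rightarrow> 'i \<Rightarrow> bool) \<Rightarrow> ('i \<Rightarrow> 'a::order) \<Rightarrow> bool" where
  "increasing_net I le x \<longleftrightarrow> directed_preorder I le \<and> monotone_on I le (\<le>) x"

text \<open>A definition cannot quantify over the type of the indices, so the index sets here
  are arbitrary directed subsets of the type of \<open>E\<close> under an arbitrary preorder unrelated
  to that of \<open>E\<close>. By \<open>quasi_KB_net\<close> below this already gives convergence along increasing
  nets with indices of any type whatsoever.\<close>

definition quasi_KB :: "('a::banach_lattice \<Rightarrow>\<^sub>L 'b::real_normed_vector) \<Rightarrow> bool" where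
  "quasi_KB T \<longleftrightarrow>
     (\<forall>(I :: 'a set) le x. increasing_net I le x \<and> x ` I \<subseteq> pos_unit_ball \<longrightarrow>
        (\<exists>y. ((\<lambda>i. blinfun_apply T (x i)) \<longlongrightarrow> y) (tails I le)))"

lemma quasi_KB_net:
  fixes I :: "'i set" and x :: "'i \<Rightarrow> 'a::banach_lattice"
    and T :: "'a \<Rightarrow>\<^sub>L 'b::real_normed_vector"
  assumes T: "quasi_KB T" and net: "increasing_net I le x" and sub: "x ` I \<subseteq> pos_unit_ball"
  shows "\<exists>y. ((\<lambda>i. blinfun_apply T (x i)) \<longlongrightarrow> y) (tails I le)"
proof -
  have dir: "directed_preorder I le" and mono: "monotone_on I le (\<le>) x"
    using net by (auto simp: increasing_net_def)
  have dirx: "directed_preorder (x ` I) (\<le>)"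
    unfolding directed_preorder_def
  proof (intro conjI ballI)
    show "x ` I \<noteq> {}" using dir by (simp add: directed_preorder_def)
    fix a b assume "a \<in> x ` I" "b \<in> x ` I"
    then obtain i j where ij: "i \<in> I" "j \<in> I" "a = x i" "b = x j" by blast
    then obtain k where "k \<in> I" "le i k" "le j k"
      using dir unfolding directed_preorder_def by blast
    then show "\<exists>k\<in>x ` I. a \<le> k \<and> b \<le> k"
      using ij mono by (auto dest: monotone_onD)
  qed (auto simp: reflp_on_def transp_on_def)
  have "increasing_net (x ` I) (\<le>) (\<lambda>z. z)"
    using dirx by (simp add: increasing_net_def monotone_on_def)
  then obtain y where y: "((\<lambda>z. blinfun_apply T z) \<longlongrightarrow> y) (tails (x ` I) (\<le>))"
    using T[unfolded quasi_KB_def, rule_format, of "x ` I" "(\<le>)" "\<lambda>z. z"] sub by auto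
  have "filterlim x (tails (x ` I) (\<le>)) (tails I le)"
    unfolding filterlim_iff eventually_tails[OF dir] eventually_tails[OF dirx]
  proof (intro allI impI)
    fix P assume "\<exists>i\<in>x ` I. \<forall>j\<in>x ` I. i \<le> j \<longrightarrow> P j"
    then show "\<exists>i\<in>I. \<forall>j\<in>I. le i j \<longrightarrow> P (x j)"
      using mono by (auto simp: monotone_on_def)
  qed
  then show ?thesis using filterlim_compose[OF y] by blast
qed

definition L_qKB :: "('a::banach_lattice \<Rightarrow>\<^sub>L 'b::real_normed_vector) set" where
  "L_qKB = {T. quasi_KB T}"

end

(* L_qKB is closed in the complete space of all bounded operators: an operator near T moves every
   point of the unit ball by little, so T maps an increasing net of the ball to a Cauchy net as
   soon as T is a norm limit of quasi-KB operators. *)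
theory Submission
  imports Defs
begin

text \<open>By reflexivity every index lies in its own tail, so no tail is empty. Completeness
  yields limits only for proper filters.\<close>

lemma tails_neq_bot: "directed_preorder I le \<Longrightarrow> tails I le \<noteq> bot"
  unfolding trivial_limit_def
  by (auto simp: eventually_tails directed_preorder_def reflp_on_def)

text \<open>The filter lives on the whole index type, whereas a net is controlled on
  \<open>I\<close> only; this lets bounds valid on \<open>I\<close> enter \<open>eventually\<close>
  arguments.\<close>

lemma eventually_tails_mem: "directed_preorder I le \<Longrightarrow> eventually (\<lambda>i. i \<in> I) (tails I le)"
  by (auto simp: eventually_tails directed_preorder_def)

text \<open>Completeness is needed for filters rather than sequences, since the nets have arbitrary
  directed index sets.\<close>

lemma cauchy_filter_convergent:
  fixes F :: "'a::complete_space filter"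
  assumes "F \<noteq> bot" "cauchy_filter F"
  shows "\<exists>y. F \<le> nhds y"
  using assms complete_UNIV[where 'a='a] unfolding complete_uniform by auto

lemma subspace_L_qKB: "subspace L_qKB"
proof (rule subspaceI)
  show "0 \<in> L_qKB"
    by (auto simp: L_qKB_def quasi_KB_def)
next
  fix S T :: "'a \<Rightarrow>\<^sub>L 'b"
  assume S: "S \<in> L_qKB" and T: "T \<in> L_qKB"
  show "S + T \<in> L_qKB"
    unfolding L_qKB_def quasi_KB_def mem_Collect_eq plus_blinfun.rep_eq
  proof (intro allI impI)
    fix I :: "'a set" and le and x :: "'a \<Rightarrow> 'a"
    assume net: "increasing_net I le x \<and> x ` I \<subseteq> pos_unit_ball"
    obtain y where "((\<lambda>i. S (x i)) \<longlongrightarrow> y) (tails I le)"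
      using S net unfolding L_qKB_def quasi_KB_def by blast
    moreover obtain z where "((\<lambda>i. T (x i)) \<longlongrightarrow> z) (tails I le)"
      using T net unfolding L_qKB_def quasi_KB_def by blast
    ultimately show "\<exists>y. ((\<lambda>i. S (x i) + T (x i)) \<longlongrightarrow> y) (tails I le)"
      using tendsto_add by blast
  qed
next
  fix c and T :: "'a \<Rightarrow>\<^sub>L 'b"
  assume T: "T \<in> L_qKB"
  show "c *\<^sub>R T \<in> L_qKB"
    unfolding L_qKB_def quasi_KB_def mem_Collect_eq scaleR_blinfun.rep_eq
  proof (intro allI impI)
    fix I :: "'a set" and le and x :: "'a \<Rightarrow> 'a"
    assume "increasing_net I le x \<and> x ` I \<subseteq> pos_unit_ball"
    then obtain y where "((\<lambda>i. T (x i)) \<longlongrightarrow> y) (tails I le)"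
      using T unfolding L_qKB_def quasi_KB_def by blast
    then show "\<exists>y. ((\<lambda>i. c *\<^sub>R T (x i)) \<longlongrightarrow> y) (tails I le)"
      using tendsto_scaleR[OF tendsto_const] by blast
  qed
qed

lemma closed_L_qKB: "closed (L_qKB :: ('a::banach_lattice \<Rightarrow>\<^sub>L 'b::banach) set)"
proof -
  have "T \<in> L_qKB" if T: "T \<in> closure L_qKB" for T :: "'a \<Rightarrow>\<^sub>L 'b"
    unfolding L_qKB_def quasi_KB_def mem_Collect_eq
  proof (intro allI impI, elim conjE)
    fix I :: "'a set" and le and x :: "'a \<Rightarrow> 'a"
    assume net: "increasing_net I le x" and ball: "x ` I \<subseteq> pos_unit_ball"
    then have dir: "directed_preorder I le"
      by (simp add: increasing_net_def)
    have nontriv: "filtermap (\<lambda>i. T (x i)) (tails I le) \<noteq> bot"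
      using tails_neq_bot[OF dir] by (simp add: filtermap_bot_iff)
    have "cauchy_filter (filtermap (\<lambda>i. T (x i)) (tails I le))"
      unfolding cauchy_filter_metric_filtermap
    proof (intro allI impI)
      fix e :: real
      assume "e > 0"
      \<comment> \<open>One quarter of \<open>e\<close> pays for replacing \<open>T\<close> by
        \<open>S\<close>, another for the distance of \<open>S (x i)\<close> from its limit; the
        resulting \<open>e / 2\<close> is spent once for each of two indices.\<close>
      then obtain S where "S \<in> L_qKB" and S: "dist S T < e / 4"
        using T unfolding closure_approachable by (metis zero_less_divide_iff zero_less_numeral)
      then obtain y where y: "((\<lambda>i. S (x i)) \<longlongrightarrow> y) (tails I le)"
        using net ball unfolding L_qKB_def quasi_KB_def by blast
      have near: "dist (T (x i)) (S (x i)) < e / 4" if "i \<in> I" for i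
      proof -
        have "norm (x i) \<le> 1"
          using ball that by (auto simp: pos_unit_ball_def)
        \<comment> \<open>Since \<open>x i\<close> lies in the unit ball, the operator norm bounds
          the error uniformly in \<open>i\<close>.\<close>
        then have "norm ((S - T) (x i)) \<le> norm (S - T)"
          using norm_blinfun[of "S - T" "x i"] mult_left_le[of "norm (x i)" "norm (S - T)"]
          by simp
        then show ?thesis
          using S by (simp add: dist_norm minus_blinfun.rep_eq norm_minus_commute)
      qed
      have "eventually (\<lambda>i. dist (S (x i)) y < e / 4) (tails I le)"
        using y by (rule tendstoD) (use \<open>e > 0\<close> in simp)
      then have "eventually (\<lambda>i. dist (T (x i)) y < e / 2) (tails I le)"
        using eventually_tails_mem[OF dir]
      proof eventually_elim
        case (elim i)
        then show ?case
          using near[of i] dist_triangle[of "T (x i)" y "S (x i)"] by simp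
      qed
      \<comment> \<open>The point \<open>y\<close> depends on \<open>S\<close> and need not be the
        limit sought; it only serves as a common centre for the values of \<open>T\<close> on a
        tail.\<close>
      then show "\<exists>P. eventually P (tails I le) \<and>
          (\<forall>i j. P i \<and> P j \<longrightarrow> dist (T (x i)) (T (x j)) < e)"
        using dist_triangle_half_l by blast
    qed
    \<comment> \<open>Convergence of the net means that its image filter lies below
      \<open>nhds y\<close>.\<close>
    with nontriv show "\<exists>y. ((\<lambda>i. T (x i)) \<longlongrightarrow> y) (tails I le)"
      unfolding filterlim_def by (rule cauchy_filter_convergent)
  qed
  then show ?thesis
    by (meson closure_subset_eq subsetI)
qed

theorem theorem1:
  shows "subspace (L_qKB :: ('a::banach_lattice \<Rightarrow>\<^sub>L 'b::banach) set)
    \<and> complete (L_qKB :: ('a \<Rightarrow>\<^sub>L 'b) set)"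
  \<comment> \<open>As \<open>'b\<close> is complete, so is the space of all bounded operators, and
    there the complete subsets are exactly the closed ones.\<close>
  using subspace_L_qKB closed_L_qKB by (auto simp: complete_eq_closed)

end
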